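(* Let $G$ be a countably infinite discrete group and let $X$ be a Borel $G$-space. If $X$ admits a Borel weakly wandering complete section, then $X$ admits a $3$-generator.
   Context: A Borel $G$-space is a standard Borel space $X$ equipped with a Borel action of $G$. A complete section is a subset of $X$ meeting every orbit. A set $A\subseteq X$ is weakly wandering if there is an infinite $H\subseteq G$ such that $hA\cap h'A=\emptyset$ for all distinct $h,h'\in H$. A $k$-generator for $X$ is a partition $\{A_n\}_{n<k}$ of $X$ into Borel sets (pieces may be empty) such that $\{gA_n : g\in G, n<k\}$ generates the Borel $\sigma$-algebra of $X$. *)

theory Defs
  imports "HOL-Analysis.Analysis" "HOL-Algebra.Group_Action"
begin

definition polish_topology :: "'x topology \<Rightarrow> bool" where
  "polish_topology T \<longleftrightarrow> separable_space T \<and> completely_metrizable_space T"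

text \<open>
  A measurable space is a value of type \<open>'x measure\<close>; only \<open>space\<close> and \<open>sets\<close> are used,
  the measure component is irrelevant.
\<close>

definition standard_borel :: "'x measure \<Rightarrow> bool" where
  "standard_borel M \<longleftrightarrow>
     (\<exists>T. polish_topology T \<and> topspace T = space M
        \<and> sets M = sigma_sets (space M) {U. openin T U})"

text \<open>
  Borelness of the action is Borelness of the map \<open>(g, x) \<mapsto> \<phi> g x\<close> on \<open>G \<times> X\<close>. The group
  is discrete, so \<open>G\<close> carries the \<open>\<sigma>\<close>-algebra of all subsets of its carrier. The definition is
  meant for countable groups only.
\<close>

definition borel_G_space ::
    "('g, 'm) monoid_scheme \<Rightarrow> 'x measure \<Rightarrow> ('g \<Rightarrow> 'x \<Rightarrow> 'x) \<Rightarrow> bool" where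
  "borel_G_space G M \<phi> \<longleftrightarrow>
     standard_borel M \<and> group_action G (space M) \<phi> \<and>
     (\<lambda>(g, x). \<phi> g x) \<in> measurable (count_space (carrier G) \<Otimes>\<^sub>M M) M"

definition complete_section ::
    "('g, 'm) monoid_scheme \<Rightarrow> 'x set \<Rightarrow> ('g \<Rightarrow> 'x \<Rightarrow> 'x) \<Rightarrow> 'x set \<Rightarrow> bool" where
  "complete_section G X \<phi> A \<longleftrightarrow> A \<subseteq> X \<and> (\<forall>Y\<in>orbits G X \<phi>. A \<inter> Y \<noteq> {})"

definition weakly_wandering ::
    "('g, 'm) monoid_scheme \<Rightarrow> 'x set \<Rightarrow> ('g \<Rightarrow> 'x \<Rightarrow> 'x) \<Rightarrow> 'x set \<Rightarrow> bool" where
  "weakly_wandering G X \<phi> A \<longleftrightarrow>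
     A \<subseteq> X \<and>
     (\<exists>H. H \<subseteq> carrier G \<and> infinite H \<and>
        (\<forall>h\<in>H. \<forall>h'\<in>H. h \<noteq> h' \<longrightarrow> \<phi> h ` A \<inter> \<phi> h' ` A = {}))"

text \<open>
  The partition is an indexed family, so that pieces may be empty; values \<open>A n\<close> with
  \<open>n \<ge> k\<close> play no role.
\<close>

definition is_k_generator ::
    "nat \<Rightarrow> ('g, 'm) monoid_scheme \<Rightarrow> 'x measure \<Rightarrow> ('g \<Rightarrow> 'x \<Rightarrow> 'x) \<Rightarrow> (nat \<Rightarrow> 'x set) \<Rightarrow> bool" where
  "is_k_generator k G M \<phi> A \<longleftrightarrow>
     (\<forall>n<k. A n \<in> sets M) \<and>
     disjoint_family_on A {..<k} \<and>
     (\<Union>n<k. A n) = space M \<and>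
     sigma_sets (space M) {\<phi> g ` A n | g n. g \<in> carrier G \<and> n < k} = sets M"

end

theory Submission
  imports Defs
begin

text \<open>
  Let \<open>W\<close> be weakly wandering via distinct elements \<open>h 0, h 1, \<dots>\<close> and let \<open>U 0, U 1, \<dots>\<close> generate
  the Borel \<open>\<sigma>\<close>-algebra. The translates of \<open>W\<close> leave room to encode the whole family \<open>U\<close> in a
  single set: take the pieces \<open>h 0 W\<close>, \<open>\<Union>n. h (n + 1) (W \<inter> U n)\<close> and the remainder. The invariant
  \<open>\<sigma>\<close>-algebra generated by them contains \<open>W\<close>, and it recovers \<open>W \<inter> U n\<close> by intersecting the second
  piece with \<open>h (n + 1) W\<close> and translating back; hence it contains every Borel subset of \<open>W\<close>.
  Since the translates of \<open>W\<close> cover the space, it contains every Borel set.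
\<close>

section \<open>Countable generation of standard Borel spaces\<close>

text \<open>Balls of radius 1/(n+1) about the points of a countable dense set form a countable
  base.\<close>

lemma separable_metrizable_imp_second_countable:
  assumes "separable_space X" "metrizable_space X"
  shows "second_countable X"
proof -
  obtain M d where Md: "Metric_space M d" and X: "X = Metric_space.mtopology M d"
    using assms(2) unfolding metrizable_space_def by blast
  interpret Metric_space M d by (rule Md)
  obtain D where D: "countable D" "D \<subseteq> M" "mtopology closure_of D = M"
    using assms(1) unfolding separable_space_def X by auto
  define \<B> where "\<B> = (\<lambda>(x, n). mball x (inverse (Suc n))) ` (D \<times> (UNIV :: nat set))"
  have "countable \<B>"
    unfolding \<B>_def using D(1) by simp
  moreover have "\<forall>V\<in>\<B>. openin mtopology V"
    unfolding \<B>_def by auto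
  moreover have "\<exists>V\<in>\<B>. x \<in> V \<and> V \<subseteq> U" if U: "openin mtopology U" and x: "x \<in> U" for U x
  proof -
    obtain r where r: "r > 0" "mball x r \<subseteq> U" and xM: "x \<in> M"
      using U x unfolding openin_mtopology by blast
    \<comment> \<open>Half of \<open>r\<close> suffices: a ball of this radius that contains
      \<open>x\<close> has all its points within twice the radius of \<open>x\<close>, hence inside
      \<open>mball x r\<close>.\<close>
    obtain n where n: "inverse (real (Suc n)) < r / 2"
      using reals_Archimedean[of "r / 2"] r(1) by auto
    have "x \<in> mtopology closure_of D"
      using D(3) xM by simp
    then obtain y where y: "y \<in> D" "y \<in> mball x (inverse (Suc n))"
      unfolding metric_closure_of by (auto dest!: spec[of _ "inverse (real (Suc n))"])
    then have d: "d x y < inverse (Suc n)" "y \<in> M" by auto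
    have "mball y (inverse (Suc n)) \<subseteq> mball x r"
    proof
      fix z assume z: "z \<in> mball y (inverse (Suc n))"
      then have "d x z \<le> d x y + d y z" using triangle xM d by simp
      with z d n xM show "z \<in> mball x r" by auto
    qed
    then have "mball y (inverse (Suc n)) \<subseteq> U"
      using r(2) by (rule subset_trans)
    moreover have "x \<in> mball y (inverse (Suc n))"
      using d xM by (simp add: commute)
    moreover have "mball y (inverse (Suc n)) \<in> \<B>"
      unfolding \<B>_def using y(1) by (intro image_eqI[of _ _ "(y, n)"]) auto
    ultimately show ?thesis
      by (intro bexI[of _ "mball y (inverse (Suc n))"] conjI)
  qed
  ultimately show ?thesis
    unfolding second_countable_def X by blast
qed

text \<open>Every open set is a countable union of members of a countable base, so the base
  generates all Borel sets. A sequence is produced because the generators are later matched with the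
  group elements \<open>h (Suc n)\<close>.\<close>

lemma standard_borel_countably_generated:
  assumes "standard_borel M"
  obtains U :: "nat \<Rightarrow> 'x set" where "sets M = sigma_sets (space M) (range U)"
proof -
  obtain T where T: "polish_topology T" "topspace T = space M"
      "sets M = sigma_sets (space M) {U. openin T U}"
    using assms unfolding standard_borel_def by blast
  have "second_countable T"
    using T(1) completely_metrizable_imp_metrizable_space separable_metrizable_imp_second_countable
    unfolding polish_topology_def by blast
  then obtain \<B> where \<B>: "countable \<B>" "\<forall>V\<in>\<B>. openin T V"
      "\<And>U x. openin T U \<Longrightarrow> x \<in> U \<Longrightarrow> \<exists>V\<in>\<B>. x \<in> V \<and> V \<subseteq> U"
    unfolding second_countable_def by metis
  \<comment> \<open>Adding the empty set, which is open anyway, makes the family nonempty, so that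
    it can be enumerated by all of the naturals.\<close>
  define U where "U = from_nat_into (insert {} \<B>)"
  have range: "range U = insert {} \<B>"
    unfolding U_def using \<B>(1) by (intro range_from_nat_into) auto
  have "sigma_sets (space M) {U. openin T U} = sigma_sets (space M) (range U)"
  proof (rule sigma_sets_eqI)
    fix V assume "V \<in> {U. openin T U}"
    then have V: "V = \<Union>{B\<in>\<B>. B \<subseteq> V}"
      using \<B>(3) by blast
    have "\<Union>{B\<in>\<B>. B \<subseteq> V} \<in> sigma_sets (space M) (range U)"
      using \<B>(1) unfolding range by (intro sigma_sets_UNION) auto
    with V show "V \<in> sigma_sets (space M) (range U)" by simp
  next
    fix V assume "V \<in> range U"
    then show "V \<in> sigma_sets (space M) {U. openin T U}"
      using \<B>(2) unfolding range by auto
  qed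
  with T(3) show ?thesis using that by simp
qed

section \<open>Translates of sets under a group action\<close>

context group_action
begin

lemma group_G: "group G"
  using group_hom group_hom.axioms(1) by blast

lemma image_mult:
  assumes "g \<in> carrier G" "h \<in> carrier G" "B \<subseteq> E"
  shows "\<phi> g ` \<phi> h ` B = \<phi> (g \<otimes> h) ` B"
  unfolding image_image
  using assms by (intro image_cong) (simp_all add: composition_rule subset_eq)

lemma image_inv_cancel:
  assumes "g \<in> carrier G" "B \<subseteq> E"
  shows "\<phi> (inv g) ` \<phi> g ` B = B"
proof -
  have "\<phi> (inv g) (\<phi> g x) = x" if "x \<in> B" for x
    using orbit_sym_aux assms that by blast
  then show ?thesis by (force simp: image_image)
qed

lemma image_cancel_inv:
  assumes "g \<in> carrier G" "B \<subseteq> E"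
  shows "\<phi> g ` \<phi> (inv g) ` B = B"
  using image_inv_cancel[of "inv g" B] assms group.inv_closed group.inv_inv group_G by metis

lemma image_subset: "g \<in> carrier G \<Longrightarrow> B \<subseteq> E \<Longrightarrow> \<phi> g ` B \<subseteq> E"
  using surj_prop by blast

text \<open>Translation by \<open>g\<close> sends generators to generators and, being a bijection of
  \<open>E\<close>, commutes with complements and countable unions.\<close>

lemma sigma_sets_translates_invariant:
  assumes g: "g \<in> carrier G" and A: "\<And>i. i \<in> I \<Longrightarrow> A i \<subseteq> E"
    and B: "B \<in> sigma_sets E {\<phi> h ` A i | h i. h \<in> carrier G \<and> i \<in> I}"
  shows "\<phi> g ` B \<in> sigma_sets E {\<phi> h ` A i | h i. h \<in> carrier G \<and> i \<in> I}"
  using B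
proof (induction rule: sigma_sets.induct)
  case (Basic B)
  then obtain h i where "h \<in> carrier G" "i \<in> I" "B = \<phi> h ` A i" by blast
  moreover from this have "\<phi> g ` B = \<phi> (g \<otimes> h) ` A i" "g \<otimes> h \<in> carrier G"
    using image_mult[OF g] A group_G g by (auto simp: group.is_monoid monoid.m_closed)
  ultimately show ?case by blast
next
  case Empty
  show ?case by (simp add: sigma_sets.Empty)
next
  case (Compl B)
  have "B \<subseteq> E"
    using image_subset A by (intro sigma_sets_into_sp[OF _ Compl.hyps]) blast
  then have "\<phi> g ` (E - B) = E - \<phi> g ` B"
    using inj_on_image_set_diff[OF inj_prop[OF g], of E B] surj_prop[OF g] by auto
  then show ?case
    using Compl.IH by (simp add: sigma_sets.Compl)
next
  case (Union B)
  then show ?case by (simp add: image_UN sigma_sets.Union)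
qed

lemma complete_section_covers:
  assumes "complete_section G E \<phi> W" "x \<in> E"
  obtains g where "g \<in> carrier G" "x \<in> \<phi> g ` W"
proof -
  have W: "W \<subseteq> E" "\<forall>Y\<in>orbits G E \<phi>. W \<inter> Y \<noteq> {}"
    using assms(1) unfolding complete_section_def by auto
  have "W \<inter> orbit G \<phi> x \<noteq> {}"
    using W(2) assms(2) unfolding orbits_def by blast
  then obtain w where w: "w \<in> W" "w \<in> orbit G \<phi> x" by blast
  then have "x \<in> orbit G \<phi> w"
    using orbit_sym assms(2) W(1) by blast
  then show ?thesis
    using that w(1) unfolding orbit_def by blast
qed

end

text \<open>The image under \<open>g\<close> is the preimage under the inverse of \<open>g\<close>,
  and the latter acts measurably as a section of the jointly measurable action map.\<close>

lemma borel_G_space_image_sets: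
  assumes "borel_G_space G M \<phi>" "g \<in> carrier G" "B \<in> sets M"
  shows "\<phi> g ` B \<in> sets M"
proof -
  interpret group_action G "space M" \<phi>
    using assms(1) by (simp add: borel_G_space_def)
  have i: "inv\<^bsub>G\<^esub> g \<in> carrier G"
    by (rule group.inv_closed[OF group_G assms(2)])
  have "(\<lambda>(g, x). \<phi> g x) \<in> measurable (count_space (carrier G) \<Otimes>\<^sub>M M) M"
    using assms(1) by (simp add: borel_G_space_def)
  from measurable_compose[OF measurable_Pair1' this, of "inv\<^bsub>G\<^esub> g"]
  have "\<phi> (inv\<^bsub>G\<^esub> g) \<in> measurable M M"
    using i by simp
  then have "\<phi> (inv\<^bsub>G\<^esub> g) -` B \<inter> space M \<in> sets M"
    using assms(3) by (rule measurable_sets)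
  moreover have "\<phi> (inv\<^bsub>G\<^esub> g) -` B \<inter> space M = \<phi> g ` B"
  proof
    show "\<phi> (inv\<^bsub>G\<^esub> g) -` B \<inter> space M \<subseteq> \<phi> g ` B"
    proof
      fix x assume x: "x \<in> \<phi> (inv\<^bsub>G\<^esub> g) -` B \<inter> space M"
      then have "\<phi> g (\<phi> (inv\<^bsub>G\<^esub> g) x) = x"
        using orbit_sym_aux[OF i, of x] group.inv_inv[OF group_G assms(2)] by simp
      with x show "x \<in> \<phi> g ` B" by force
    qed
    show "\<phi> g ` B \<subseteq> \<phi> (inv\<^bsub>G\<^esub> g) -` B \<inter> space M"
    proof
      fix y assume "y \<in> \<phi> g ` B"
      then obtain x where x: "x \<in> B" "x \<in> space M" "y = \<phi> g x"
        using sets.sets_into_space[OF assms(3)] by blast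
      then show "y \<in> \<phi> (inv\<^bsub>G\<^esub> g) -` B \<inter> space M"
        using orbit_sym_aux[OF assms(2)] element_image[OF assms(2)] by simp
    qed
  qed
  ultimately show ?thesis by simp
qed

section \<open>Encoding a generating sequence in the translates of the section\<close>

theorem proposition7p2:
  fixes G :: "('g, 'm) monoid_scheme"
    and M :: "'x measure"
    and \<phi> :: "'g \<Rightarrow> 'x \<Rightarrow> 'x"
  assumes "group G"
    and "countable (carrier G)"
    and "infinite (carrier G)"
    and "borel_G_space G M \<phi>"
    and "\<exists>A\<in>sets M. weakly_wandering G (space M) \<phi> A \<and> complete_section G (space M) \<phi> A"
  shows "\<exists>A. is_k_generator 3 G M \<phi> A"
proof -
  interpret group_action G "space M" \<phi>
    using assms(4) by (simp add: borel_G_space_def)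
  have image_sets: "\<phi> g ` B \<in> sets M" if "g \<in> carrier G" "B \<in> sets M" for g B
    by (rule borel_G_space_image_sets[OF assms(4) that])
  obtain W where W: "W \<in> sets M" "weakly_wandering G (space M) \<phi> W"
      "complete_section G (space M) \<phi> W"
    using assms(5) by blast
  have WX: "W \<subseteq> space M" using W(1) by (rule sets.sets_into_space)
  obtain H where H: "H \<subseteq> carrier G" "infinite H"
      "\<forall>h\<in>H. \<forall>h'\<in>H. h \<noteq> h' \<longrightarrow> \<phi> h ` W \<inter> \<phi> h' ` W = {}"
    using W(2) unfolding weakly_wandering_def by (elim conjE exE)
  obtain h :: "nat \<Rightarrow> 'g" where h: "inj h" "range h \<subseteq> H"
    using infinite_countable_subset[OF H(2)] by (elim conjE exE)
  have hG: "h n \<in> carrier G" for n using h(2) H(1) by blast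
  have disj: "\<phi> (h m) ` W \<inter> \<phi> (h n) ` W = {}" if "m \<noteq> n" for m n
  proof -
    have "h m \<in> H" "h n \<in> H" "h m \<noteq> h n"
      using h that by (auto dest: injD)
    then show ?thesis by (rule H(3)[rule_format])
  qed
  obtain U :: "nat \<Rightarrow> 'x set" where U: "sets M = sigma_sets (space M) (range U)"
    using assms(4) standard_borel_countably_generated by (auto simp: borel_G_space_def)
  have US: "U n \<in> sets M" for n unfolding U by (rule sigma_sets.Basic) simp

  define P where "P = \<phi> (h 0) ` W"
  \<comment> \<open>The shift to \<open>Suc n\<close> reserves the translate by \<open>h 0\<close>
    for \<open>P\<close>, which keeps \<open>P\<close> and \<open>Q\<close> disjoint.\<close>
  define Q where "Q = (\<Union>n. \<phi> (h (Suc n)) ` (W \<inter> U n))"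
  define A :: "nat \<Rightarrow> 'x set" where
    "A = (\<lambda>n. if n = 0 then P else if n = 1 then Q else space M - (P \<union> Q))"
  have PQ: "P \<in> sets M" "Q \<in> sets M"
    unfolding P_def Q_def
    by (intro image_sets sets.countable_nat_UN image_subsetI sets.Int hG W(1) US)+
  then have PQX: "P \<subseteq> space M" "Q \<subseteq> space M" by (auto dest: sets.sets_into_space)
  have PQ_disj: "P \<inter> Q = {}"
  proof -
    have "P \<inter> \<phi> (h (Suc n)) ` (W \<inter> U n) = {}" for n
      unfolding P_def using disj[of 0 "Suc n"] by blast
    then show ?thesis unfolding Q_def by blast
  qed
  have A_sets: "A n \<in> sets M" for n unfolding A_def using PQ by auto
  have three: "{..<3} = {0, 1, 2::nat}" by auto

  define S where "S = sigma_sets (space M) {\<phi> g ` A n | g n. g \<in> carrier G \<and> n < 3}"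
  have S_gen: "\<phi> g ` A n \<in> S" if "g \<in> carrier G" "n < 3" for g n
    unfolding S_def using that by (intro sigma_sets.Basic) blast
  have gens_Pow: "{\<phi> g ` A n | g n. g \<in> carrier G \<and> n < 3} \<subseteq> Pow (space M)"
    using sets.sets_into_space[OF image_sets[OF _ A_sets]] by blast
  interpret S: sigma_algebra "space M" S
    unfolding S_def using gens_Pow by (rule sigma_algebra_sigma_sets)
  have S_inv: "\<phi> g ` B \<in> S" if "g \<in> carrier G" "B \<in> S" for g B
    using sigma_sets_translates_invariant[of g "{..<3}" A B] that sets.sets_into_space[OF A_sets]
    unfolding S_def by simp
  have A_S: "A n \<in> S" if "n < 3" for n
  proof -
    \<comment> \<open>Any group element would do here: translating forth and back recovers
      \<open>A n\<close> itself from its translates.\<close>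
    have "\<phi> (inv\<^bsub>G\<^esub> h 0) ` \<phi> (h 0) ` A n \<in> S"
      by (intro S_inv S_gen hG group.inv_closed[OF assms(1)] that)
    then show ?thesis
      by (simp add: image_inv_cancel[OF hG sets.sets_into_space[OF A_sets]])
  qed
  have translate_back: "B \<in> S" if "g \<in> carrier G" "B \<subseteq> space M" "\<phi> g ` B \<in> S" for g B
    using S_inv[OF group.inv_closed[OF assms(1) that(1)] that(3)] image_inv_cancel that by simp

  have W_S: "W \<in> S"
    using translate_back[OF hG WX] A_S[of 0] unfolding A_def P_def by simp
  have WU_S: "W \<inter> U n \<in> S" for n
  proof -
    \<comment> \<open>The translates of \<open>W\<close> are pairwise disjoint, so only the n-th
      term of the union \<open>Q\<close> meets this one.\<close>
    have "Q \<inter> \<phi> (h (Suc n)) ` W = \<phi> (h (Suc n)) ` (W \<inter> U n)"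
    proof
      show "Q \<inter> \<phi> (h (Suc n)) ` W \<subseteq> \<phi> (h (Suc n)) ` (W \<inter> U n)"
      proof
        fix x assume x: "x \<in> Q \<inter> \<phi> (h (Suc n)) ` W"
        then obtain m where m: "x \<in> \<phi> (h (Suc m)) ` (W \<inter> U m)" unfolding Q_def by blast
        then have "m = n" using x disj[of "Suc m" "Suc n"] by blast
        with m show "x \<in> \<phi> (h (Suc n)) ` (W \<inter> U n)" by simp
      qed
      show "\<phi> (h (Suc n)) ` (W \<inter> U n) \<subseteq> Q \<inter> \<phi> (h (Suc n)) ` W"
        unfolding Q_def by blast
    qed
    moreover have "Q \<inter> \<phi> (h (Suc n)) ` W \<in> S"
      using A_S[of 1] S_inv[OF hG W_S] unfolding A_def by auto
    ultimately show ?thesis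
      using translate_back[OF hG, of "W \<inter> U n" "Suc n"] WX by auto
  qed
  \<comment> \<open>Induction over the \<sigma>-algebra generated by \<open>U\<close>, with
    complements taken relative to \<open>W\<close>.\<close>
  have trace: "W \<inter> B \<in> S" if "B \<in> sets M" for B
    using that unfolding U
  proof (induction rule: sigma_sets.induct)
    case (Basic B)
    then show ?case using WU_S by blast
  next
    case (Compl B)
    have "W \<inter> (space M - B) = W - W \<inter> B" using WX by blast
    then show ?case using Compl.IH W_S by auto
  next
    case (Union B)
    then have "(\<Union>n. W \<inter> B n) \<in> S" by (intro S.countable_nat_UN) auto
    then show ?case by (simp only: Int_UN_distrib)
  qed simp
  have "B \<in> S" if B: "B \<in> sets M" for B
  proof -
    have BX: "B \<subseteq> space M" using B by (rule sets.sets_into_space)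
    have piece: "B \<inter> \<phi> g ` W \<in> S" if g: "g \<in> carrier G" for g
    proof -
      let ?C = "\<phi> (inv\<^bsub>G\<^esub> g) ` B"
      have i: "inv\<^bsub>G\<^esub> g \<in> carrier G" using group.inv_closed[OF assms(1) g] .
      \<comment> \<open>Pulling \<open>B\<close> back by \<open>g\<close> moves the part of
        \<open>B\<close> in the translate of \<open>W\<close> into \<open>W\<close>, where
        \<open>trace\<close> applies; invariance of \<open>S\<close> then carries it back.\<close>
      have "\<phi> g ` (W \<inter> ?C) = \<phi> g ` W \<inter> \<phi> g ` ?C"
        using inj_on_image_Int[OF inj_prop[OF g] WX image_subset[OF i BX]] .
      also have "\<phi> g ` ?C = B" by (rule image_cancel_inv[OF g BX])
      finally show ?thesis
        using S_inv[OF g trace[OF image_sets[OF i B]]] by (simp add: Int_commute)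
    qed
    have "B = (\<Union>g\<in>carrier G. B \<inter> \<phi> g ` W)"
    proof
      show "B \<subseteq> (\<Union>g\<in>carrier G. B \<inter> \<phi> g ` W)"
      proof
        fix x assume x: "x \<in> B"
        obtain g where "g \<in> carrier G" "x \<in> \<phi> g ` W"
          by (rule complete_section_covers[OF W(3) subsetD[OF BX x]])
        with x show "x \<in> (\<Union>g\<in>carrier G. B \<inter> \<phi> g ` W)" by (intro UN_I IntI)
      qed
    qed auto
    \<comment> \<open>Countability of the group makes this a countable union.\<close>
    also have "\<dots> \<in> S"
      using assms(2) piece by (rule S.countable_UN'')
    finally show ?thesis .
  qed
  moreover have "S \<subseteq> sets M"
    unfolding S_def using image_sets A_sets by (intro sets.sigma_sets_subset) blast
  ultimately have "S = sets M" by blast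
  moreover have "disjoint_family_on A {..<3}"
    unfolding disjoint_family_on_def three A_def using PQ_disj by auto
  moreover have "(\<Union>n<3. A n) = space M"
    unfolding three A_def using PQX by auto
  ultimately have "is_k_generator 3 G M \<phi> A"
    unfolding is_k_generator_def S_def using A_sets by simp
  then show ?thesis by (rule exI[of _ A])
qed

end
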